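(* Let $n\ge1$. (i) For $b\in\mathbb{C}$ with $(n+1)b\notin\mathbb{N}_0$, the $\mathfrak{sl}_{n+1}(\mathbb{C})$-module $M_b^{\{1,\ldots,n\}}$ is simple. (ii) For every $b\in\mathbb{C}$ and every subset $S\subset\{1,\ldots,n\}$ with $S\ne\{1,\ldots,n\}$, the module $M_b^S$ is simple.
   Context: $\mathbb{N}_0$ is the set of nonnegative integers. Let $e_{i,j}$ be the matrix units, $h_k:=e_{k,k}-\frac1{n+1}\sum_{m=1}^{n+1}e_{m,m}$ for $1\le k\le n$, $\mathcal{P}:=\mathbb{C}[h_1,\ldots,h_n]$, and $\overline{h}:=\sum_{i=1}^n h_i$. For $1\le i\le n$, $\sigma_i$ is the algebra automorphism of $\mathcal{P}$ with $\sigma_i(h_k)=h_k-\delta_{i,k}$. For $S\subset\{1,\ldots,n\}$ and $b\in\mathbb{C}$, $M_b^S$ is the vector space $\mathcal{P}$ with the $\mathfrak{sl}_{n+1}$-action, for $i,j,k\in\{1,\ldots,n\}$ (with $i\ne j$ in the last formula): $h_k\cdot f=h_kf$; $\ e_{i,n+1}\cdot f=(\overline h+b)\,u_i\,\sigma_if$; $\ e_{n+1,j}\cdot f=-w_j\,\sigma_j^{-1}f$; $\ e_{i,j}\cdot f=u_iw_j\,\sigma_i\sigma_j^{-1}f$, where $u_i=1$ if $i\in S$, $u_i=h_i-b-1$ if $i\notin S$, and $w_j=h_j-b$ if $j\in S$, $w_j=1$ if $j\notin S$. *)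

theory Defs
  imports "HOL-Analysis.Analysis" "HOL-Library.Poly_Mapping"
begin

section \<open>The Lie algebra of traceless matrices and its modules\<close>

text \<open>
  The index set \<open>{1, \<dots>, n}\<close> is a finite type \<open>'n\<close> with \<open>CARD('n) = n\<close> (types are nonempty,
  so \<open>n \<ge> 1\<close>). The index set \<open>{1, \<dots>, n + 1}\<close> is \<open>'n option\<close>, where \<open>None\<close> stands for \<open>n + 1\<close>.
\<close>

definition sl :: "(complex^'m^'m) set" where
  "sl = {A. trace A = 0}"

definition lie_bracket :: "complex^'m^'m \<Rightarrow> complex^'m^'m \<Rightarrow> complex^'m^'m" where
  "lie_bracket A B = A ** B - B ** A"

definition mscale :: "complex \<Rightarrow> complex^'m^'m \<Rightarrow> complex^'m^'m" where
  "mscale c A = (\<chi> i j. c * A $ i $ j)"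

definition matrix_unit :: "'m \<Rightarrow> 'm \<Rightarrow> complex^'m^'m" where
  "matrix_unit i j = (\<chi> r s. if r = i \<and> s = j then 1 else 0)"

definition hmat :: "'n \<Rightarrow> complex^('n option)^('n::finite option)" where
  "hmat k = matrix_unit (Some k) (Some k)
     - mscale (1 / of_nat (CARD('n) + 1)) (\<Sum>m\<in>UNIV. matrix_unit m m)"

locale sl_module = vector_space scale
  for scale :: "complex \<Rightarrow> 'v::ab_group_add \<Rightarrow> 'v" +
  fixes act :: "complex^'m^'m \<Rightarrow> 'v \<Rightarrow> 'v"
  assumes act_add_left: "A \<in> sl \<Longrightarrow> B \<in> sl \<Longrightarrow> act (A + B) v = act A v + act B v"
    and act_scale_left: "A \<in> sl \<Longrightarrow> act (mscale c A) v = scale c (act A v)"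
    and act_linear: "A \<in> sl \<Longrightarrow> Vector_Spaces.linear scale scale (act A)"
    and act_bracket: "A \<in> sl \<Longrightarrow> B \<in> sl \<Longrightarrow>
      act (lie_bracket A B) v = act A (act B v) - act B (act A v)"
begin

definition submodule :: "'v set \<Rightarrow> bool" where
  "submodule W \<longleftrightarrow> subspace W \<and> (\<forall>A\<in>sl. \<forall>v\<in>W. act A v \<in> W)"

end

locale simple_sl_module = sl_module scale act
  for scale :: "complex \<Rightarrow> 'v::ab_group_add \<Rightarrow> 'v"
    and act :: "complex^'m^'m \<Rightarrow> 'v \<Rightarrow> 'v" +
  assumes nontrivial: "\<exists>v::'v. v \<noteq> 0"
    and simple: "submodule W \<Longrightarrow> W = {0} \<or> W = UNIV"


section \<open>The polynomial algebra in the variables \<open>h\<^sub>k\<close>\<close>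

text \<open>The monoid algebra of the exponent vectors; the product is the convolution product.\<close>

type_synonym 'n cpoly = "('n \<Rightarrow>\<^sub>0 nat) \<Rightarrow>\<^sub>0 complex"

definition pconst :: "complex \<Rightarrow> 'n cpoly" where
  "pconst c = Poly_Mapping.single 0 c"

definition pscale :: "complex \<Rightarrow> 'n cpoly \<Rightarrow> 'n cpoly" where
  "pscale c f = pconst c * f"

definition hvar :: "'n \<Rightarrow> 'n cpoly" where
  "hvar k = Poly_Mapping.single (Poly_Mapping.single k 1) 1"

definition hbar :: "'n::finite cpoly" where
  "hbar = (\<Sum>i\<in>UNIV. hvar i)"

definition psubst :: "('n \<Rightarrow> 'n cpoly) \<Rightarrow> 'n::finite cpoly \<Rightarrow> 'n cpoly" where
  "psubst g f = (\<Sum>m\<in>Poly_Mapping.keys f.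
     pconst (Poly_Mapping.lookup f m) * (\<Prod>k\<in>UNIV. g k ^ Poly_Mapping.lookup m k))"

definition sigma :: "'n \<Rightarrow> 'n::finite cpoly \<Rightarrow> 'n cpoly" where
  "sigma i = psubst (\<lambda>k. hvar k - (if k = i then 1 else 0))"


section \<open>The modules \<open>M\<^sub>b\<^sup>S\<close>\<close>

definition ucoef :: "complex \<Rightarrow> 'n set \<Rightarrow> 'n \<Rightarrow> 'n cpoly" where
  "ucoef b S i = (if i \<in> S then 1 else hvar i - pconst b - 1)"

definition wcoef :: "complex \<Rightarrow> 'n set \<Rightarrow> 'n \<Rightarrow> 'n cpoly" where
  "wcoef b S j = (if j \<in> S then hvar j - pconst b else 1)"

text \<open>The action of the matrix unit at an off-diagonal position; the value at \<open>(None, None)\<close>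
  is never used.\<close>

fun unit_act :: "complex \<Rightarrow> 'n set \<Rightarrow> 'n option \<Rightarrow> 'n option \<Rightarrow> 'n::finite cpoly \<Rightarrow> 'n cpoly" where
  "unit_act b S (Some i) None f = (hbar + pconst b) * ucoef b S i * sigma i f"
| "unit_act b S None (Some j) f = - wcoef b S j * inv (sigma j) f"
| "unit_act b S (Some i) (Some j) f = ucoef b S i * wcoef b S j * sigma i (inv (sigma j) f)"
| "unit_act b S None None f = 0"

text \<open>
  The linear extension from the basis \<open>h\<^sub>k\<close>, \<open>e\<^sub>i\<^sub>j\<close> (\<open>i \<noteq> j\<close>) of \<open>sl\<close>. The coefficients are the
  coordinates of \<open>A\<close> in this basis, see \<open>sl_expansion\<close> below; \<open>M_act_hmat\<close> and
  \<open>M_act_matrix_unit\<close> give the action of the basis elements.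
\<close>

definition M_act ::
    "complex \<Rightarrow> 'n set \<Rightarrow> complex^('n option)^('n option) \<Rightarrow> 'n::finite cpoly \<Rightarrow> 'n cpoly" where
  "M_act b S A f =
     (\<Sum>k\<in>UNIV. pscale (A $ Some k $ Some k - A $ None $ None) (hvar k * f))
   + (\<Sum>(i, j)\<in>{(i, j). i \<noteq> j}. pscale (A $ i $ j) (unit_act b S i j f))"


section \<open>Basic facts\<close>

lemma sum_UNIV_option:
  fixes F :: "'n::finite option \<Rightarrow> 'b::comm_monoid_add"
  shows "sum F UNIV = F None + (\<Sum>k\<in>UNIV. F (Some k))"
  by (simp add: UNIV_option_conv sum.reindex)

lemma sum_diag_unit: "(\<Sum>m\<in>UNIV. matrix_unit m m) = (mat 1 :: complex^'m^'m)"
proof -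
  have "(\<Sum>m\<in>UNIV. if r = m \<and> s = m then 1 else 0) = (if r = s then 1 else (0::complex))"
    for r s :: 'm
    by (cases "r = s") (auto intro: sum.neutral)
  then show ?thesis
    by (simp add: vec_eq_iff matrix_unit_def mat_def)
qed

lemma hmat_nth:
  fixes k :: "'n::finite"
  shows "hmat k $ r $ s = (if r = Some k \<and> s = Some k then 1 else 0)
    - (if r = s then 1 / of_nat (CARD('n) + 1) else 0)"
  unfolding hmat_def sum_diag_unit
  by (simp add: matrix_unit_def mscale_def mat_def)

lemma hmat_in_sl: "hmat k \<in> sl"
proof -
  have "1 + of_nat CARD('a) \<noteq> (0::complex)"
    by (metis of_nat_Suc of_nat_neq_0)
  then have "1 / (1 + of_nat CARD('a)) + of_nat CARD('a) / (1 + of_nat CARD('a)) = (1::complex)"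
    by (metis add_divide_distrib divide_self)
  then have "1 - of_nat CARD('a) / (1 + of_nat CARD('a)) = 1 / (1 + of_nat CARD('a) :: complex)"
    by (metis add_diff_cancel_right')
  then show ?thesis
    by (simp add: sl_def trace_def hmat_nth sum_UNIV_option sum_subtractf)
qed

lemma matrix_unit_in_sl: "i \<noteq> j \<Longrightarrow> matrix_unit i j \<in> sl"
  by (auto simp: sl_def trace_def matrix_unit_def intro!: sum.neutral)

lemma sl_expansion:
  fixes A :: "complex^('n option)^('n::finite option)"
  assumes "A \<in> sl"
  shows "A = (\<Sum>k\<in>UNIV. mscale (A $ Some k $ Some k - A $ None $ None) (hmat k))
    + (\<Sum>(i, j)\<in>{(i, j). i \<noteq> j}. mscale (A $ i $ j) (matrix_unit i j))"
    (is "A = ?D + ?E")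
proof -
  let ?n = "of_nat (CARD('n) + 1) :: complex"
  let ?a = "\<lambda>k. A $ Some k $ Some k - A $ None $ None"
  have n0: "?n \<noteq> 0"
    by (simp del: of_nat_add of_nat_Suc)
  have tr: "A $ None $ None + (\<Sum>k\<in>UNIV. A $ Some k $ Some k) = 0"
    using assms by (simp add: sl_def trace_def sum_UNIV_option)
  have "sum ?a UNIV = - A $ None $ None - of_nat CARD('n) * A $ None $ None"
    using tr by (simp add: sum_subtractf eq_neg_iff_add_eq_0 add.commute)
  then have s: "sum ?a UNIV = - ?n * A $ None $ None"
    by (simp add: algebra_simps)
  have D: "?D $ r $ s = (case r of None \<Rightarrow> 0 | Some k \<Rightarrow> if s = r then ?a k else 0)
      + (if r = s then A $ None $ None else 0)" for r s
  proof -
    have "?D $ r $ s = (\<Sum>k\<in>UNIV. ?a k * (if r = Some k \<and> s = Some k then 1 else 0))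
        - (\<Sum>k\<in>UNIV. ?a k * (if r = s then 1 / ?n else 0))"
      by (simp only: sum_component mscale_def vec_lambda_beta hmat_nth right_diff_distrib
          sum_subtractf)
    also have "(\<Sum>k\<in>UNIV. ?a k * (if r = s then 1 / ?n else 0))
        = sum ?a UNIV * (if r = s then 1 / ?n else 0)"
      by (rule sum_distrib_right [symmetric])
    also have "\<dots> = (if r = s then - A $ None $ None else 0)"
      unfolding s using n0 by (simp del: of_nat_add of_nat_Suc)
    also have "(\<Sum>k\<in>UNIV. ?a k * (if r = Some k \<and> s = Some k then 1 else 0))
        = (case r of None \<Rightarrow> 0 | Some k \<Rightarrow> if s = r then ?a k else 0)"
    proof (cases r)
      case (Some l)
      have "(\<Sum>k\<in>UNIV. ?a k * (if r = Some k \<and> s = Some k then 1 else 0))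
          = (\<Sum>k\<in>UNIV. if l = k then (if s = Some l then ?a l else 0) else 0)"
        using Some by (intro sum.cong) auto
      then show ?thesis using Some by simp
    qed simp
    finally show ?thesis by simp
  qed
  have E: "?E $ r $ s = (if r = s then 0 else A $ r $ s)" for r s
  proof -
    have "?E $ r $ s = (\<Sum>p\<in>{(i, j). i \<noteq> j}. if p = (r, s) then A $ r $ s else 0)"
      unfolding sum_component
      by (rule sum.cong) (auto simp: mscale_def matrix_unit_def split: if_splits)
    then show ?thesis
      by (auto simp: sum.delta)
  qed
  have "A $ r $ s = (?D + ?E) $ r $ s" for r s
    unfolding vector_add_component D E by (cases r) simp_all
  then show ?thesis
    unfolding vec_eq_iff by (intro allI)
qed

lemma pconst_simps [simp]: "pconst 0 = 0" "pconst 1 = 1"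
  by (simp_all add: pconst_def)

lemma pconst_add: "pconst (a + b) = pconst a + pconst b"
  by (simp add: pconst_def single_add)

lemma pconst_mult: "pconst (a * b) = pconst a * pconst b"
  by (simp add: pconst_def mult_single)

lemma vector_space_pscale: "vector_space pscale"
  by unfold_locales (simp_all add: pscale_def pconst_add pconst_mult algebra_simps)

lemma M_act_matrix_unit:
  fixes i j :: "'n::finite option"
  assumes "i \<noteq> j"
  shows "M_act b S (matrix_unit i j) f = unit_act b S i j f"
proof -
  have "(\<Sum>(r, s)\<in>{(r, s). r \<noteq> s}. pscale (matrix_unit i j $ r $ s) (unit_act b S r s f))
      = (\<Sum>p\<in>{(r, s). r \<noteq> s}. if p = (i, j) then unit_act b S i j f else 0)"
    by (rule sum.cong) (auto simp: matrix_unit_def pscale_def split: if_splits)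
  also have "\<dots> = unit_act b S i j f"
    using assms by (auto simp: sum.delta)
  moreover have "(\<Sum>k\<in>UNIV. pscale (matrix_unit i j $ Some k $ Some k
      - matrix_unit i j $ None $ None) (hvar k * f)) = 0"
    using assms by (auto simp: matrix_unit_def pscale_def intro!: sum.neutral)
  ultimately show ?thesis
    by (simp add: M_act_def)
qed

lemma M_act_hmat: "M_act b S (hmat k) f = hvar k * f"
proof -
  have "(\<Sum>l\<in>UNIV. pscale (hmat k $ Some l $ Some l - hmat k $ None $ None) (hvar l * f))
      = (\<Sum>l\<in>UNIV. if l = k then hvar k * f else 0)"
    by (rule sum.cong) (auto simp: hmat_nth pscale_def)
  moreover have "(\<Sum>(r, s)\<in>{(r, s). r \<noteq> s}. pscale (hmat k $ r $ s) (unit_act b S r s f)) = 0"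
    by (auto simp: hmat_nth pscale_def intro!: sum.neutral)
  ultimately show ?thesis
    by (simp add: M_act_def)
qed

lemma psubst_superset:
  assumes "finite K" "Poly_Mapping.keys f \<subseteq> K"
  shows "psubst g f = (\<Sum>m\<in>K.
     pconst (Poly_Mapping.lookup f m) * (\<Prod>k\<in>UNIV. g k ^ Poly_Mapping.lookup m k))"
  unfolding psubst_def
  by (rule sum.mono_neutral_left) (use assms in \<open>auto simp: in_keys_iff\<close>)

lemma psubst_add: "psubst g (p + q) = psubst g p + psubst g q"
proof -
  let ?K = "Poly_Mapping.keys p \<union> Poly_Mapping.keys q"
  have "Poly_Mapping.keys (p + q) \<subseteq> ?K"
    by (rule keys_add)
  then show ?thesis
    by (simp add: psubst_superset [of ?K] lookup_add pconst_add algebra_simps sum.distrib)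
qed

lemma psubst_single:
  "psubst g (Poly_Mapping.single m c) = pconst c * (\<Prod>k\<in>UNIV. g k ^ Poly_Mapping.lookup m k)"
  by (subst psubst_superset [of "{m}"]) auto

lemma psubst_pconst [simp]: "psubst g (pconst c) = pconst c"
  unfolding pconst_def by (subst psubst_single) (simp add: pconst_def)

lemma psubst_0 [simp]: "psubst g 0 = 0"
  using psubst_pconst [of g 0] by (simp only: pconst_simps)

lemma psubst_1 [simp]: "psubst g 1 = 1"
  using psubst_pconst [of g 1] by (simp only: pconst_simps)

lemma psubst_hvar [simp]: "psubst g (hvar k) = g k"
proof -
  have "(\<Prod>l\<in>UNIV. g l ^ Poly_Mapping.lookup (Poly_Mapping.single k (1::nat)) l)
      = (\<Prod>l\<in>UNIV. if l = k then g k else 1)"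
    by (intro prod.cong) (auto simp: lookup_single)
  then show ?thesis
    by (simp add: hvar_def psubst_single)
qed

lemma cpoly_induct [case_names single add]:
  fixes p :: "'n cpoly"
  assumes single: "\<And>m c. P (Poly_Mapping.single m c)"
    and add: "\<And>p q. P p \<Longrightarrow> P q \<Longrightarrow> P (p + q)"
  shows "P p"
proof -
  have p0: "P 0"
    using single [of 0 0] by simp
  have "P (\<Sum>m\<in>K. Poly_Mapping.single m (Poly_Mapping.lookup p m))" if "finite K" for K
    using that by (induction K) (auto intro: p0 single add)
  moreover have "(\<Sum>m\<in>Poly_Mapping.keys p. Poly_Mapping.single m (Poly_Mapping.lookup p m)) = p"
    by (rule poly_mapping_eqI)
       (auto simp: lookup_sum lookup_single when_def in_keys_iff sum.delta)
  ultimately show ?thesis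
    by (metis finite_keys)
qed

lemma psubst_mult: "psubst g (p * q) = psubst g p * psubst g q"
proof (induction p rule: cpoly_induct)
  case (single m c)
  show ?case
  proof (induction q rule: cpoly_induct)
    case (single l d)
    show ?case
      by (simp add: mult_single psubst_single pconst_mult lookup_add power_add prod.distrib
          algebra_simps)
  next
    case (add p q)
    then show ?case by (simp add: distrib_left psubst_add)
  qed
next
  case (add p r)
  then show ?case by (simp add: distrib_right psubst_add)
qed

lemma psubst_minus: "psubst g (- p) = - psubst g p"
  using psubst_add [of g p "- p"] by (simp add: eq_neg_iff_add_eq_0 add.commute)

lemma psubst_diff: "psubst g (p - q) = psubst g p - psubst g q"
  using psubst_add [of g p "- q"] by (simp add: psubst_minus)

lemma psubst_power: "psubst g (p ^ r) = psubst g p ^ r"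
  by (induction r) (simp_all add: psubst_mult)

lemma psubst_prod: "finite K \<Longrightarrow> psubst g (\<Prod>x\<in>K. p x) = (\<Prod>x\<in>K. psubst g (p x))"
  by (induction K rule: finite_induct) (simp_all add: psubst_mult)

lemma psubst_psubst: "psubst g (psubst g' p) = psubst (\<lambda>k. psubst g (g' k)) p"
  by (induction p rule: cpoly_induct)
     (simp_all add: psubst_single psubst_add psubst_mult psubst_prod psubst_power)

lemma psubst_id: "psubst hvar p = p"
proof (induction p rule: cpoly_induct)
  case (single m c)
  have pow: "hvar k ^ r = Poly_Mapping.single (Poly_Mapping.single k r) 1" for k :: 'a and r
    by (induction r) (simp_all add: hvar_def mult_single flip: single_add)
  have "(\<Prod>k\<in>K. hvar k ^ Poly_Mapping.lookup m k)
      = Poly_Mapping.single (\<Sum>k\<in>K. Poly_Mapping.single k (Poly_Mapping.lookup m k)) 1"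
    if "finite K" for K
    using that by (induction K rule: finite_induct) (simp_all add: pow mult_single)
  moreover have "(\<Sum>k\<in>UNIV. Poly_Mapping.single k (Poly_Mapping.lookup m k)) = m"
    by (rule poly_mapping_eqI) (simp add: lookup_sum lookup_single when_def)
  ultimately show ?case
    by (simp add: psubst_single pconst_def mult_single)
qed (simp add: psubst_add)

lemma sigma_hvar: "sigma i (hvar k) = hvar k - (if k = i then 1 else 0)"
  by (simp add: sigma_def)

lemma sigma_hom:
  "sigma i (p + q) = sigma i p + sigma i q"
  "sigma i (p * q) = sigma i p * sigma i q"
  "sigma i (pconst c) = pconst c"
  by (simp_all add: sigma_def psubst_add psubst_mult)

lemma inv_sigma: "inv (sigma i) = psubst (\<lambda>k. hvar k + (if k = i then 1 else 0))"
  and bij_sigma: "bij (sigma i)"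
proof -
  let ?t = "psubst (\<lambda>k. hvar k + (if k = i then 1 else 0))"
  have "sigma i \<circ> ?t = id" "?t \<circ> sigma i = id"
    by (auto simp: fun_eq_iff sigma_def psubst_psubst psubst_add psubst_diff
        if_distrib [of "psubst _"] psubst_id cong: if_cong)
  then show "bij (sigma i)" "inv (sigma i) = ?t"
    by (auto intro: o_bij inv_unique_comp)
qed

end

theory Submission
  imports Defs
begin

text \<open>
  A submodule \<open>W\<close> is an ideal, and shifts lower degrees: \<open>\<sigma>\<^sub>i f - f\<close> has smaller degree than \<open>f\<close>, and
  a polynomial fixed by all shifts is constant. If some \<open>j\<close> is not in \<open>S\<close>, then \<open>W\<close> is invariant
  under \<open>\<sigma>\<^sub>j\<^sup>-\<^sup>1\<close> for \<open>j \<notin> S\<close> and under \<open>\<sigma>\<^sub>i \<sigma>\<^sub>j\<^sup>-\<^sup>1\<close> for \<open>i \<in> S\<close>, so a nonzero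
  element of minimal degree is a constant. If \<open>S\<close> is the whole index set, only
  \<open>(hbar + b) \<sigma>\<^sub>i\<close> preserves \<open>W\<close>; the same descent then yields a product
  \<open>(hbar + b) (hbar + b - 1) \<cdots> (hbar + b - r + 1)\<close> in \<open>W\<close>. Applying powers of
  \<open>(h\<^sub>j - b) \<sigma>\<^sub>j\<^sup>-\<^sup>1\<close> shows that any common zero of \<open>W\<close> would satisfy \<open>h\<^sub>j \<in> b - \<nat>\<close> and
  \<open>hbar \<in> \<nat> - b\<close>, which forces \<open>(n + 1) b \<in> \<nat>\<close>.
\<close>

section \<open>Shift automorphisms\<close>

abbreviation tau :: "'n \<Rightarrow> 'n::finite cpoly \<Rightarrow> 'n cpoly" where
  "tau j \<equiv> inv (sigma j)"

lemma sigma_ring_hom: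
  "sigma i 0 = 0" "sigma i 1 = 1" "sigma i (- p) = - sigma i p"
  "sigma i (p - q) = sigma i p - sigma i q"
  "finite K \<Longrightarrow> sigma i (\<Prod>x\<in>K. g x) = (\<Prod>x\<in>K. sigma i (g x))"
  by (simp_all add: sigma_def psubst_minus psubst_diff psubst_prod)

lemma tau_hom:
  "tau i 0 = 0" "tau i 1 = 1" "tau i (- p) = - tau i p"
  "tau i (p + q) = tau i p + tau i q"
  "tau i (p - q) = tau i p - tau i q"
  "tau i (p * q) = tau i p * tau i q"
  "tau i (pconst c) = pconst c"
  "finite K \<Longrightarrow> tau i (\<Prod>x\<in>K. g x) = (\<Prod>x\<in>K. tau i (g x))"
  by (simp_all add: inv_sigma psubst_add psubst_minus psubst_diff psubst_mult psubst_prod)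

lemma tau_hvar: "tau i (hvar k) = hvar k + (if k = i then 1 else 0)"
  by (simp add: inv_sigma)

lemma sigma_sum: "sigma i (sum g K) = (\<Sum>k\<in>K. sigma i (g k))"
  by (induction K rule: infinite_finite_induct) (simp_all add: sigma_hom sigma_ring_hom)

lemma tau_sum: "tau i (sum g K) = (\<Sum>k\<in>K. tau i (g k))"
  by (induction K rule: infinite_finite_induct) (simp_all add: tau_hom)

lemma sigma_hbar: "sigma i hbar = hbar - 1"
  by (simp add: hbar_def sigma_sum sigma_hvar sum_subtractf)

lemma tau_hbar: "tau i hbar = hbar + 1"
  by (simp add: hbar_def tau_sum tau_hvar sum.distrib)

lemma sigma_tau [simp]: "sigma i (tau i f) = f"
  by (simp add: bij_sigma bij_is_surj surj_f_inv_f)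

lemma tau_sigma [simp]: "tau i (sigma i f) = f"
  by (simp add: bij_sigma bij_is_inj inv_f_f)

lemma sigma_commute: "sigma i (sigma j f) = sigma j (sigma i f)"
proof -
  have "psubst (\<lambda>l. hvar l - (if l = x then 1 else 0)) (hvar k - (if k = y then 1 else 0))
      = hvar k - (if k = x then 1 else 0) - (if k = y then 1 else 0)" for x y k :: 'a
    by (auto simp: psubst_diff)
  then show ?thesis
    unfolding sigma_def psubst_psubst
    by simp (rule arg_cong [where f = "\<lambda>g. psubst g f"], auto)
qed

lemma sigma_tau_commute: "sigma i (tau j f) = tau j (sigma i f)"
  using arg_cong [OF sigma_commute [of i j "tau j f"], of "tau j"] by simp

lemma tau_commute: "tau i (tau j f) = tau j (tau i f)"
  using arg_cong [OF sigma_tau_commute [of i j "tau i f"], of "tau i"] by simp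


section \<open>The module structure\<close>

text \<open>
  The operators \<open>u\<^sub>i \<sigma>\<^sub>i\<close> and \<open>w\<^sub>j \<sigma>\<^sub>j\<^sup>-\<^sup>1\<close> satisfy the relations of the coordinates and the partial
  derivatives in the Weyl algebra. The values at \<open>None\<close> are chosen such that
  \<open>e\<^sub>p\<^sub>q\<close> acts as \<open>xop p \<circ> dop q\<close> for all \<open>p \<noteq> q\<close>.
\<close>

fun xop :: "complex \<Rightarrow> 'n set \<Rightarrow> 'n option \<Rightarrow> 'n::finite cpoly \<Rightarrow> 'n cpoly" where
  "xop b S None f = - f"
| "xop b S (Some i) f = ucoef b S i * sigma i f"

fun dop :: "complex \<Rightarrow> 'n set \<Rightarrow> 'n option \<Rightarrow> 'n::finite cpoly \<Rightarrow> 'n cpoly" where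
  "dop b S None f = (hbar + pconst b + 1) * f"
| "dop b S (Some j) f = wcoef b S j * tau j f"

lemma sigma_coef:
  "sigma i (ucoef b S j) = (if i = j \<and> j \<notin> S then ucoef b S j - 1 else ucoef b S j)"
  "sigma i (wcoef b S j) = (if i = j \<and> j \<in> S then wcoef b S j - 1 else wcoef b S j)"
  "tau i (ucoef b S j) = (if i = j \<and> j \<notin> S then ucoef b S j + 1 else ucoef b S j)"
  "tau i (wcoef b S j) = (if i = j \<and> j \<in> S then wcoef b S j + 1 else wcoef b S j)"
  by (auto simp: ucoef_def wcoef_def sigma_hom sigma_ring_hom tau_hom sigma_hvar tau_hvar)

lemma xop_commute: "xop b S p (xop b S r f) = xop b S r (xop b S p f)"
  by (cases p; cases r)
     (auto simp: sigma_hom sigma_ring_hom sigma_coef sigma_commute algebra_simps)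

text \<open>The extra terms come from \<open>dop b S None\<close>, multiplication by
  \<open>hbar + b + 1\<close>: every \<open>tau j\<close> raises \<open>hbar\<close> by one.\<close>

lemma dop_commute: "dop b S q (dop b S s f) = dop b S s (dop b S q f)
    + (if s = None then dop b S q f else 0) - (if q = None then dop b S s f else 0)"
  by (cases q; cases s)
     (auto simp: tau_hom tau_hbar sigma_coef tau_commute algebra_simps)

text \<open>For indices other than \<open>None\<close> this is the Weyl relation [d_q, x_r] =
  delta_qr. The last summand records that \<open>sigma i\<close> lowers \<open>hbar\<close> by one;
  at \<open>q = r = None\<close> it cancels the delta.\<close>

lemma dop_xop: "dop b S q (xop b S r f) = xop b S r (dop b S q f)
    + (if q = r then f else 0) + (if q = None then xop b S r f else 0)"
proof (cases q; cases r)
  fix j i assume "q = Some j" "r = Some i"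
  then show ?thesis
    by (cases "i = j"; cases "i \<in> S")
       (auto simp: tau_hom sigma_hom sigma_ring_hom sigma_coef sigma_tau_commute ucoef_def
          wcoef_def algebra_simps sigma_hvar tau_hvar)
qed (auto simp: tau_hom sigma_hom sigma_ring_hom sigma_hbar algebra_simps)

lemma xop_linear:
  "xop b S p 0 = 0" "xop b S p (f + g) = xop b S p f + xop b S p g"
  "xop b S p (f - g) = xop b S p f - xop b S p g"
  "xop b S p (pconst c * f) = pconst c * xop b S p f"
  by (cases p; simp add: sigma_hom sigma_ring_hom algebra_simps)+

lemma dop_linear:
  "dop b S p 0 = 0" "dop b S p (f + g) = dop b S p f + dop b S p g"
  "dop b S p (pconst c * f) = pconst c * dop b S p f"
  by (cases p; simp add: tau_hom algebra_simps)+

text \<open>The diagonal shift by \<open>b + 1\<close> is chosen so that the diagonal units act as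
  \<open>hvar k\<close> and \<open>- hbar\<close>. The identity matrix then acts as zero, and the
  operators represent all of gl, not only sl.\<close>

definition eop :: "complex \<Rightarrow> 'n set \<Rightarrow> 'n option \<Rightarrow> 'n option \<Rightarrow> 'n::finite cpoly \<Rightarrow> 'n cpoly" where
  "eop b S p q f = xop b S p (dop b S q f) + (if p = q then pconst (b + 1) * f else 0)"

lemma eop_linear:
  "eop b S p q 0 = 0" "eop b S p q (f + g) = eop b S p q f + eop b S p q g"
  "eop b S p q (pconst c * f) = pconst c * eop b S p q f"
  by (auto simp: eop_def xop_linear dop_linear distrib_left mult.left_commute)

lemma eop_sum: "eop b S p q (sum g K) = (\<Sum>k\<in>K. eop b S p q (g k))"
  by (induction K rule: infinite_finite_induct) (simp_all add: eop_linear)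

lemma eop_bracket:
  "eop b S p q (eop b S r s f) - eop b S r s (eop b S p q f)
    = (if q = r then eop b S p s f else 0) - (if s = p then eop b S r q f else 0)"
proof -
  define P where "P x y f = xop b S x (dop b S y f)" for x y f
  have PP: "P x y (P z w g) = xop b S x (xop b S z (dop b S y (dop b S w g)))
      + (if y = z then P x w g else 0)
      + (if y = None then xop b S x (xop b S z (dop b S w g)) else 0)" for x y z w g
    unfolding P_def by (auto simp: dop_xop xop_linear)
  \<comment> \<open>The \<open>None\<close> terms left by \<open>PP\<close> cancel against those
    produced by exchanging \<open>dop b S q\<close> and \<open>dop b S s\<close>.\<close>
  have bracket: "P p q (P r s f) - P r s (P p q f)
      = (if q = r then P p s f else 0) - (if s = p then P r q f else 0)"
    unfolding PP xop_commute [of b S r p]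
    by (subst dop_commute [of b S q s]) (auto simp: xop_linear)
  have E: "eop b S x y g = P x y g + (if x = y then pconst (b + 1) * g else 0)" for x y g
    by (simp add: eop_def P_def)
  have lin: "P x y 0 = 0" "P x y (g + g') = P x y g + P x y g'"
      "P x y (pconst c * g) = pconst c * P x y g"
    for x y c g g'
    by (simp_all add: P_def xop_linear dop_linear)
  have "eop b S p q (eop b S r s f) - eop b S r s (eop b S p q f)
      = P p q (P r s f) - P r s (P p q f)"
    by (simp add: E lin distrib_left)
  then show ?thesis
    unfolding bracket by (auto simp: E)
qed

lemma eop_offdiag: "p \<noteq> q \<Longrightarrow> eop b S p q f = unit_act b S p q f"
  by (cases p; cases q)
     (auto simp: eop_def sigma_hom sigma_ring_hom sigma_hbar sigma_coef algebra_simps)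

lemma eop_diag: "eop b S p p f = (case p of None \<Rightarrow> - hbar * f | Some k \<Rightarrow> hvar k * f)"
  by (cases p)
     (auto simp: eop_def sigma_hom sigma_coef ucoef_def wcoef_def pconst_add algebra_simps
       sigma_hvar sigma_ring_hom)

section \<open>The action of a general matrix and the bracket relation\<close>

lemma pconst_diff: "pconst (x - y) = pconst x - pconst y"
  by (simp add: eq_diff_eq flip: pconst_add)

text \<open>Since the diagonal operators sum to zero, this holds for every matrix, of any trace.
  Treating all matrix units uniformly reduces the bracket relation to
  \<open>eop_bracket\<close>.\<close>

lemma M_act_eq: "M_act b S A f = (\<Sum>p\<in>UNIV. \<Sum>q\<in>UNIV. pconst (A $ p $ q) * eop b S p q f)"
proof -
  have "(\<Sum>p\<in>UNIV. \<Sum>q\<in>UNIV. pconst (A $ p $ q) * eop b S p q f)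
      = (\<Sum>(p, q)\<in>UNIV. pconst (A $ p $ q) * eop b S p q f)"
    by (simp add: sum.cartesian_product)
  also have "\<dots> = (\<Sum>(p, q)\<in>{(p, q). p \<noteq> q}. pconst (A $ p $ q) * eop b S p q f)
      + (\<Sum>(p, q)\<in>{(p, q). p = q}. pconst (A $ p $ q) * eop b S p q f)"
    by (subst sum.union_disjoint [symmetric]) (auto intro!: sum.cong)
  also have "(\<Sum>(p, q)\<in>{(p, q). p = q}. pconst (A $ p $ q) * eop b S p q f)
      = (\<Sum>p\<in>UNIV. pconst (A $ p $ p) * eop b S p p f)"
    by (rule sum.reindex_bij_witness [of _ "\<lambda>p. (p, p)" fst]) auto
  also have "\<dots> = (\<Sum>k\<in>UNIV. pscale (A $ Some k $ Some k - A $ None $ None) (hvar k * f))"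
    by (simp add: sum_UNIV_option eop_diag pscale_def pconst_diff left_diff_distrib sum_subtractf
        hbar_def sum_distrib_left sum_distrib_right mult.assoc)
  also have "(\<Sum>(p, q)\<in>{(p, q). p \<noteq> q}. pconst (A $ p $ q) * eop b S p q f)
      = (\<Sum>(p, q)\<in>{(p, q). p \<noteq> q}. pscale (A $ p $ q) (unit_act b S p q f))"
    by (rule sum.cong) (auto simp: eop_offdiag pscale_def)
  finally show ?thesis
    by (simp add: M_act_def)
qed

lemma pconst_sum: "pconst (sum g K) = (\<Sum>k\<in>K. pconst (g k))"
  by (induction K rule: infinite_finite_induct) (simp_all add: pconst_add)

lemma M_act_M_act:
  "M_act b S A (M_act b S B f) = (\<Sum>p\<in>UNIV. \<Sum>q\<in>UNIV. \<Sum>r\<in>UNIV. \<Sum>s\<in>UNIV.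
     pconst (A $ p $ q) * pconst (B $ r $ s) * eop b S p q (eop b S r s f))"
  by (simp add: M_act_eq eop_sum eop_linear sum_distrib_left mult.assoc)

lemma M_act_matrix_mult:
  "M_act b S (A ** B) f = (\<Sum>p\<in>UNIV. \<Sum>q\<in>UNIV. \<Sum>s\<in>UNIV.
     pconst (A $ p $ q) * pconst (B $ q $ s) * eop b S p s f)"
proof -
  have "(\<Sum>s\<in>UNIV. pconst ((A ** B) $ p $ s) * eop b S p s f) = (\<Sum>q\<in>UNIV. \<Sum>s\<in>UNIV.
     pconst (A $ p $ q) * pconst (B $ q $ s) * eop b S p s f)" for p
    by (subst sum.swap)
       (simp add: matrix_matrix_mult_def pconst_sum pconst_mult sum_distrib_right)
  then show ?thesis
    by (simp add: M_act_eq)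
qed

lemma M_act_bracket:
  "M_act b S (lie_bracket A B) f = M_act b S A (M_act b S B f) - M_act b S B (M_act b S A f)"
proof -
  let ?c = "\<lambda>p q r s. pconst (A $ p $ q) * pconst (B $ r $ s)"
  have pairs: "(\<Sum>p\<in>UNIV. \<Sum>q\<in>UNIV. F p q) = (\<Sum>x\<in>UNIV \<times> UNIV. F (fst x) (snd x))"
    for F :: "'a option \<Rightarrow> 'a option \<Rightarrow> 'a cpoly"
    by (simp only: sum.cartesian_product' fst_conv snd_conv)
  have swap: "(\<Sum>p\<in>UNIV. \<Sum>q\<in>UNIV. \<Sum>r\<in>UNIV. \<Sum>s\<in>UNIV. g p q r s)
      = (\<Sum>r\<in>UNIV. \<Sum>s\<in>UNIV. \<Sum>p\<in>UNIV. \<Sum>q\<in>UNIV. g p q r s)"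
    for g :: "'a option \<Rightarrow> 'a option \<Rightarrow> 'a option \<Rightarrow> 'a option \<Rightarrow> 'a cpoly"
    unfolding pairs by (rule sum.swap)
  have BA: "M_act b S B (M_act b S A f) = (\<Sum>p\<in>UNIV. \<Sum>q\<in>UNIV. \<Sum>r\<in>UNIV. \<Sum>s\<in>UNIV.
      ?c p q r s * eop b S r s (eop b S p q f))"
    unfolding M_act_M_act by (subst swap) (simp add: mult.commute)
  have "M_act b S A (M_act b S B f) - M_act b S B (M_act b S A f)
      = (\<Sum>p\<in>UNIV. \<Sum>q\<in>UNIV. \<Sum>r\<in>UNIV. \<Sum>s\<in>UNIV. ?c p q r s *
          ((if q = r then eop b S p s f else 0) - (if s = p then eop b S r q f else 0)))"
    unfolding BA eop_bracket [symmetric] unfolding M_act_M_act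
    by (simp add: right_diff_distrib sum_subtractf)
  \<comment> \<open>Contracting along the two Kronecker deltas gives the entries of
    \<open>A ** B\<close> and \<open>B ** A\<close> respectively.\<close>
  also have "\<dots> = (\<Sum>p\<in>UNIV. \<Sum>q\<in>UNIV. \<Sum>r\<in>UNIV. \<Sum>s\<in>UNIV.
        if q = r then ?c p q r s * eop b S p s f else 0)
      - (\<Sum>p\<in>UNIV. \<Sum>q\<in>UNIV. \<Sum>r\<in>UNIV. \<Sum>s\<in>UNIV.
        if s = p then ?c p q r s * eop b S r q f else 0)"
    by (simp add: right_diff_distrib sum_subtractf if_distrib [of "(*) _"] cong: if_cong)
  also have "(\<Sum>p\<in>UNIV. \<Sum>q\<in>UNIV. \<Sum>r\<in>UNIV. \<Sum>s\<in>UNIV.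
      if q = r then ?c p q r s * eop b S p s f else 0) = M_act b S (A ** B) f"
  proof -
    have "(\<Sum>r\<in>UNIV. \<Sum>s\<in>UNIV. if q = r then ?c p q r s * eop b S p s f else 0)
        = (\<Sum>s\<in>UNIV. ?c p q q s * eop b S p s f)" for p q
    proof -
      have "(\<Sum>r\<in>UNIV. \<Sum>s\<in>UNIV. if q = r then ?c p q r s * eop b S p s f else 0)
        = (\<Sum>r\<in>UNIV. if q = r then (\<Sum>s\<in>UNIV. ?c p q r s * eop b S p s f) else 0)"
        by (intro sum.cong) auto
      then show ?thesis by simp
    qed
    then show ?thesis
      by (simp add: M_act_matrix_mult)
  qed
  also have "(\<Sum>p\<in>UNIV. \<Sum>q\<in>UNIV. \<Sum>r\<in>UNIV. \<Sum>s\<in>UNIV.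
      if s = p then ?c p q r s * eop b S r q f else 0) = M_act b S (B ** A) f"
  proof -
    have "(\<Sum>p\<in>UNIV. \<Sum>q\<in>UNIV. \<Sum>r\<in>UNIV. \<Sum>s\<in>UNIV.
      if s = p then ?c p q r s * eop b S r q f else 0)
      = (\<Sum>p\<in>UNIV. \<Sum>q\<in>UNIV. \<Sum>r\<in>UNIV. ?c p q r p * eop b S r q f)"
      by simp
    also have "\<dots> = (\<Sum>r\<in>UNIV. \<Sum>p\<in>UNIV. \<Sum>q\<in>UNIV. ?c p q r p * eop b S r q f)"
      by (subst (2) sum.swap, subst sum.swap) (rule refl)
    finally show ?thesis
      by (simp add: M_act_matrix_mult mult.commute)
  qed
  also have "M_act b S (A ** B) f - M_act b S (B ** A) f = M_act b S (lie_bracket A B) f"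
    by (simp add: M_act_eq lie_bracket_def pconst_diff left_diff_distrib sum_subtractf)
  finally show ?thesis ..
qed

lemma sl_module_M: "sl_module pscale (M_act b S)"
proof -
  interpret vector_space "pscale :: complex \<Rightarrow> 'a cpoly \<Rightarrow> _"
    by (rule vector_space_pscale)
  show ?thesis
  proof (intro sl_module.intro sl_module_axioms.intro vector_space_pscale)
    fix A B :: "complex^('a option)^('a option)" and c and v :: "'a cpoly"
    show "M_act b S (A + B) v = M_act b S A v + M_act b S B v"
      by (simp add: M_act_eq pconst_add distrib_right sum.distrib)
    show "M_act b S (mscale c A) v = pscale c (M_act b S A v)"
      by (simp add: M_act_eq mscale_def pscale_def pconst_mult sum_distrib_left mult.assoc)
    show "Vector_Spaces.linear pscale pscale (M_act b S A)"
      by unfold_locales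
        (simp_all add: M_act_eq eop_linear pscale_def distrib_left sum.distrib
          sum_distrib_left mult.left_commute)
    show "M_act b S (lie_bracket A B) v
        = M_act b S A (M_act b S B v) - M_act b S B (M_act b S A v)"
      by (rule M_act_bracket)
  qed
qed


section \<open>Degrees and shifts\<close>

text \<open>Degree strictly below the given number, so that \<open>deg_less 0\<close> holds for \<open>0\<close> only.\<close>

inductive deg_less :: "nat \<Rightarrow> 'n::finite cpoly \<Rightarrow> bool" where
  zero: "deg_less d 0"
| const: "deg_less (Suc d) (pconst c)"
| add: "deg_less d f \<Longrightarrow> deg_less d g \<Longrightarrow> deg_less d (f + g)"
| mult: "deg_less d f \<Longrightarrow> deg_less (Suc d) (hvar k * f)"

lemma deg_less_0: "deg_less 0 f \<Longrightarrow> f = 0"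
  by (induction "0::nat" f rule: deg_less.induct) auto

lemma deg_less_Suc: "deg_less d f \<Longrightarrow> deg_less (Suc d) f"
  by (induction rule: deg_less.induct) (auto intro: deg_less.intros)

lemma deg_less_mono: "d \<le> e \<Longrightarrow> deg_less d f \<Longrightarrow> deg_less e f"
  by (induction e rule: dec_induct) (auto intro: deg_less_Suc)

lemma deg_less_scale: "deg_less d f \<Longrightarrow> deg_less d (pconst c * f)"
  by (induction rule: deg_less.induct)
     (auto simp: distrib_left mult.left_commute simp flip: pconst_mult intro: deg_less.intros)

lemma deg_less_minus: "deg_less d (f :: 'a::finite cpoly) \<Longrightarrow> deg_less d (- f)"
  using deg_less_scale [of d f "-1"] pconst_diff [of 0 1, where ?'a = 'a] by simp

lemma deg_less_1: "deg_less (Suc 0) f \<Longrightarrow> \<exists>c. f = pconst c"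
proof (induction "Suc 0" f rule: deg_less.induct)
  case zero
  then show ?case by (metis pconst_simps(1))
next
  case (add f g)
  then show ?case by (metis pconst_add)
next
  case (mult f k)
  then show ?case by (metis deg_less_0 mult_zero_right pconst_simps(1))
qed auto

lemma deg_less_exists: "\<exists>d. deg_less d (f :: 'n::finite cpoly)"
proof (induction f rule: cpoly_induct)
  case (single m c)
  have pow: "\<exists>d. deg_less d (hvar k ^ r * g)" if "\<exists>d. deg_less d g" for k r and g :: "'n cpoly"
    using that by (induction r) (auto simp: mult.assoc intro: deg_less.mult)
  have "\<exists>d. deg_less d ((\<Prod>k\<in>K. hvar k ^ Poly_Mapping.lookup m k) * pconst c)" if "finite K" for K
    using that
    by (induction K rule: finite_induct) (auto simp: mult.assoc intro!: pow deg_less.const)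
  then show ?case
    using psubst_single [of hvar m c] by (simp add: psubst_id mult.commute)
next
  case (add p q)
  then obtain d e where "deg_less d p" "deg_less e q" by blast
  then have "deg_less (max d e) p" "deg_less (max d e) q"
    by (auto intro: deg_less_mono [rotated])
  then show ?case by (auto intro: deg_less.add)
qed

lemma deg_less_mult_diff: "d > 0 \<or> g = 0 \<Longrightarrow> deg_less (d - 1) g \<Longrightarrow> deg_less d (hvar k * g)"
  by (cases d) (auto intro: deg_less.intros)

text \<open>Product rule: \<open>tau i (hvar k * f) - hvar k * f\<close> equals
  \<open>hvar k * (tau i f - f)\<close>, plus \<open>tau i f\<close> when
  \<open>k = i\<close>.\<close>

lemma deg_less_tau: "deg_less d f \<Longrightarrow> deg_less (d - 1) (tau i f - f)"
proof (induction rule: deg_less.induct)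
  case (add d f g)
  then have "deg_less (d - 1) ((tau i f - f) + (tau i g - g))"
    by (intro deg_less.add)
  then show ?case by (simp add: tau_hom algebra_simps)
next
  case (mult d f k)
  have "deg_less d (hvar k * (tau i f - f))"
    using mult deg_less_0 [of f] by (intro deg_less_mult_diff) (cases d; simp add: tau_hom)+
  moreover have "deg_less d (tau i f)"
    using deg_less.add [OF deg_less_mono [OF _ mult.IH] mult.hyps] by simp
  ultimately have "deg_less d (hvar k * (tau i f - f) + (if k = i then tau i f else 0))"
    by (auto intro: deg_less.intros)
  then show ?case by (auto simp: tau_hom tau_hvar algebra_simps split: if_splits)
qed (auto simp: tau_hom intro: deg_less.intros)

lemma deg_less_sigma: "deg_less d f \<Longrightarrow> deg_less (d - 1) (sigma i f - f)"
proof (induction rule: deg_less.induct)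
  case (add d f g)
  then have "deg_less (d - 1) ((sigma i f - f) + (sigma i g - g))"
    by (intro deg_less.add)
  then show ?case by (simp add: sigma_hom algebra_simps)
next
  case (mult d f k)
  have "deg_less d (hvar k * (sigma i f - f))"
    using mult deg_less_0 [of f] by (intro deg_less_mult_diff) (cases d; simp add: sigma_ring_hom)+
  moreover have "deg_less d (- sigma i f)"
    using deg_less.add [OF deg_less_mono [OF _ mult.IH] mult.hyps]
    by (intro deg_less_minus) simp
  ultimately have "deg_less d (hvar k * (sigma i f - f) + (if k = i then - sigma i f else 0))"
    by (auto intro: deg_less.intros simp del: add_uminus_conv_diff)
  then show ?case by (auto simp: sigma_hom sigma_hvar algebra_simps split: if_splits)
qed (auto simp: sigma_hom sigma_ring_hom intro: deg_less.intros)

lemma of_nat_pconst: "of_nat r = pconst (of_nat r)"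
  by (induction r) (simp_all add: pconst_add)

text \<open>The Euler-type operator \<open>\<Sum>\<^sub>i h\<^sub>i (\<sigma>\<^sub>i\<^sup>-\<^sup>1 - 1)\<close> multiplies the top-degree part of a polynomial by its degree.\<close>

lemma deg_less_euler:
  "deg_less d f \<Longrightarrow> deg_less (d - 1) ((\<Sum>i\<in>UNIV. hvar i * (tau i f - f)) - of_nat (d - 1) * f)"
proof (induction rule: deg_less.induct)
  case (add d f g)
  then have "deg_less (d - 1) (((\<Sum>i\<in>UNIV. hvar i * (tau i f - f)) - of_nat (d - 1) * f)
      + ((\<Sum>i\<in>UNIV. hvar i * (tau i g - g)) - of_nat (d - 1) * g))"
    by (intro deg_less.add)
  then show ?case by (simp add: tau_hom algebra_simps sum.distrib sum_subtractf)
next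
  case (const d c)
  show ?case
  proof (cases d)
    case (Suc e)
    have "deg_less d (- pconst (of_nat d * c))"
      unfolding Suc by (intro deg_less_minus deg_less.const)
    then show ?thesis by (simp add: tau_hom of_nat_pconst pconst_mult)
  qed (simp add: tau_hom deg_less.zero)
next
  case (mult d f k)
  show ?case
  proof (cases d)
    case 0
    then show ?thesis
      using mult.hyps deg_less_0 [of f] by (auto simp: tau_hom intro: deg_less.zero)
  next
    case (Suc e)
    let ?N = "\<lambda>f. \<Sum>i\<in>UNIV. hvar i * (tau i f - f)"
    have "tau i (hvar k * f) - hvar k * f = hvar k * (tau i f - f) + (if i = k then tau k f else 0)"
      for i by (simp add: tau_hom tau_hvar algebra_simps)
    then have "?N (hvar k * f) = hvar k * ?N f + (\<Sum>i\<in>UNIV. if i = k then hvar k * tau k f else 0)"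
      by (simp add: distrib_left sum.distrib sum_distrib_left mult.left_commute
          if_distrib [of "(*) _"] cong: if_cong)
    \<comment> \<open>Writing \<open>tau k f\<close> as \<open>f + (tau k f - f)\<close>, the part
      \<open>hvar k * f\<close> raises the multiplier from \<open>e\<close> to \<open>d\<close>; the
      remainder has lower degree.\<close>
    then have "?N (hvar k * f) - of_nat d * (hvar k * f)
        = hvar k * (?N f - of_nat e * f) + hvar k * (tau k f - f)"
      by (simp add: Suc algebra_simps)
    moreover have "deg_less d (hvar k * (?N f - of_nat e * f))"
      using mult.IH by (simp add: Suc deg_less.mult)
    moreover have "deg_less d (hvar k * (tau k f - f))"
      using deg_less_tau [OF mult.hyps, of k] by (simp add: Suc deg_less.mult)
    ultimately show ?thesis
      by (simp add: deg_less.add)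
  qed
qed (auto simp: tau_hom intro: deg_less.intros)

text \<open>The Euler-type operator vanishes on \<open>f\<close>, so by
  \<open>deg_less_euler\<close> the multiple \<open>d * f\<close> has smaller degree than the bound
  allows. Dividing by \<open>d\<close> lowers the bound until only constants remain.\<close>

lemma shift_invariant_const:
  fixes f :: "'a::finite cpoly"
  assumes "\<And>i. tau i f = f"
  shows "\<exists>c. f = pconst c"
proof -
  obtain d where "deg_less d f"
    using deg_less_exists by blast
  then have "deg_less (Suc 0) f"
  proof (induction d)
    case (Suc d)
    show ?case
    proof (cases "d = 0")
      case False
      have "deg_less d (- (pconst (of_nat d) * f))"
        using deg_less_euler [OF Suc.prems] by (simp add: assms of_nat_pconst)
      then have "deg_less d (pconst (- 1 / of_nat d) * - (pconst (of_nat d) * f))"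
        by (rule deg_less_scale)
      also have "pconst (- 1 / of_nat d) * - (pconst (of_nat d) * f)
          = - (pconst (- 1 / of_nat d * of_nat d) * f)"
        by (simp only: pconst_mult mult.assoc mult_minus_right)
      also have "\<dots> = f"
        using False pconst_diff [of 0 1, where ?'a = 'a] by simp
      finally show ?thesis by (rule Suc.IH)
    qed (use Suc.prems in simp)
  qed (simp add: deg_less_Suc)
  then show ?thesis by (rule deg_less_1)
qed


section \<open>Submodules\<close>

locale M_submodule =
  fixes b :: complex and S :: "'n::finite set" and W :: "'n cpoly set"
  assumes submodule: "sl_module.submodule pscale (M_act b S) W"
begin

lemma zero: "0 \<in> W"
  and add: "f \<in> W \<Longrightarrow> g \<in> W \<Longrightarrow> f + g \<in> W"
  and pconst_mult_closed: "f \<in> W \<Longrightarrow> pconst c * f \<in> W"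
  and hvar_mult: "f \<in> W \<Longrightarrow> hvar k * f \<in> W"
  and unit_act_closed: "p \<noteq> q \<Longrightarrow> f \<in> W \<Longrightarrow> unit_act b S p q f \<in> W"
proof -
  interpret sl_module pscale "M_act b S"
    by (rule sl_module_M)
  have W: "subspace W" and act: "A \<in> sl \<Longrightarrow> f \<in> W \<Longrightarrow> M_act b S A f \<in> W" for A f
    using submodule by (auto simp: submodule_def)
  show "0 \<in> W" "f \<in> W \<Longrightarrow> g \<in> W \<Longrightarrow> f + g \<in> W" "f \<in> W \<Longrightarrow> pconst c * f \<in> W"
    using W subspace_0 subspace_add subspace_scale [of W f c] by (auto simp: pscale_def)
  show "f \<in> W \<Longrightarrow> hvar k * f \<in> W"
    using act [OF hmat_in_sl] by (simp add: M_act_hmat)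
  show "p \<noteq> q \<Longrightarrow> f \<in> W \<Longrightarrow> unit_act b S p q f \<in> W"
    using act [OF matrix_unit_in_sl] by (simp add: M_act_matrix_unit)
qed

text \<open>Here \<open>deg_less\<close> only serves as a presentation of polynomials by constants,
  sums and multiplication by variables.\<close>

lemma mult: "f \<in> W \<Longrightarrow> g * f \<in> W"
proof -
  assume f: "f \<in> W"
  obtain d where "deg_less d g"
    using deg_less_exists by blast
  then show ?thesis
    by (induction rule: deg_less.induct)
       (auto simp: f zero distrib_right mult.assoc intro: add pconst_mult_closed hvar_mult)
qed

lemma uminus: "f \<in> W \<Longrightarrow> - f \<in> W"
  using mult [of f "- 1"] by simp

lemma diff: "f \<in> W \<Longrightarrow> g \<in> W \<Longrightarrow> f - g \<in> W"
  using add [of f "- g"] uminus [of g] by simp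

lemma sum: "(\<And>x. x \<in> K \<Longrightarrow> g x \<in> W) \<Longrightarrow> sum g K \<in> W"
  by (induction K rule: infinite_finite_induct) (auto intro: zero add)

lemma pconst_cancel: "pconst c * f \<in> W \<Longrightarrow> c \<noteq> 0 \<Longrightarrow> f \<in> W"
  using mult [of "pconst c * f" "pconst (1 / c)"] by (simp flip: mult.assoc pconst_mult)

lemma one_imp_UNIV: "1 \<in> W \<Longrightarrow> W = UNIV"
  using mult [of 1] by auto

text \<open>Modulo \<open>W\<close>, apply the factors to \<open>g\<close> one at a time: the factor
  at which the class first becomes zero kills a nonzero multiple of \<open>g\<close>. This is how
  eigenvectors in the quotient are found.\<close>

lemma prod_kills:
  assumes "finite K" "g \<notin> W" "(\<Prod>a\<in>K. l a) * g \<in> W"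
  shows "\<exists>h. \<exists>a\<in>K. h * g \<notin> W \<and> l a * (h * g) \<in> W"
  using assms
proof (induction K rule: finite_induct)
  case (insert a K)
  show ?case
  proof (cases "(\<Prod>a\<in>K. l a) * g \<in> W")
    case True
    then show ?thesis using insert by blast
  next
    case False
    moreover have "l a * ((\<Prod>a\<in>K. l a) * g) \<in> W"
      using insert by (simp add: mult.assoc)
    ultimately show ?thesis by blast
  qed
qed simp

section \<open>Proper subsets: descent to a constant\<close>

lemma one_in_proper:
  assumes j0: "j0 \<notin> S" and "f \<in> W" "f \<noteq> 0"
  shows "1 \<in> W"
proof -
  have tau: "tau j g \<in> W" if "j \<notin> S" "g \<in> W" for j g
    using uminus [OF unit_act_closed [of None "Some j" g]] that by (simp add: wcoef_def)
  \<comment> \<open>Both coefficients are 1 for \<open>i \<in> S\<close> and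
    \<open>j0 \<notin> S\<close>, so \<open>e_{i,j0}\<close> acts by shifts alone.\<close>
  have sigma: "sigma i (tau j0 g) \<in> W" if "i \<in> S" "g \<in> W" for i g
    using unit_act_closed [of "Some i" "Some j0" g] that j0
    by (auto simp: ucoef_def wcoef_def)
  obtain d where "deg_less d f"
    using deg_less_exists by blast
  then show ?thesis
    using assms(2,3)
  proof (induction d arbitrary: f)
    case 0
    then show ?case using deg_less_0 by blast
  next
    case (Suc d)
    have deg: "deg_less d (tau i f - f)" "deg_less d (sigma i f - f)" for i
      using deg_less_tau [OF Suc.prems(1)] deg_less_sigma [OF Suc.prems(1)] by simp_all
    show ?case
    proof (cases "\<exists>j. j \<notin> S \<and> tau j f \<noteq> f")
      case True
      then obtain j where j: "j \<notin> S" "tau j f \<noteq> f" by blast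
      show ?thesis
        by (rule Suc.IH [OF deg(1) [of j]]) (use j Suc.prems in \<open>auto intro: diff tau\<close>)
    next
      case fix_tau: False
      show ?thesis
      proof (cases "\<exists>i\<in>S. sigma i f \<noteq> f")
        case True
        then obtain i where i: "i \<in> S" "sigma i f \<noteq> f" by blast
        have "sigma i f \<in> W"
          using sigma [OF i(1) Suc.prems(2)] fix_tau j0 by auto
        show ?thesis
          by (rule Suc.IH [OF deg(2) [of i]]) (use i Suc.prems \<open>sigma i f \<in> W\<close> in \<open>auto intro: diff\<close>)
      next
        case False
        have "tau i f = f" for i
          using fix_tau False tau_sigma [of i f] by (cases "i \<in> S") auto
        then obtain c where c: "f = pconst c"
          using shift_invariant_const by blast
        then show ?thesis
          using Suc.prems pconst_cancel [of c 1] by (cases "c = 0") auto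
      qed
    qed
  qed
qed

section \<open>The whole index set: products of linear factors and eigenvalues\<close>

definition hbar_prod :: "nat \<Rightarrow> 'n cpoly" where
  "hbar_prod r = (\<Prod>m<r. hbar + pconst (b - of_nat m))"

lemma hbar_prod_Suc: "hbar_prod (Suc r) = (hbar + pconst (b - of_nat r)) * hbar_prod r"
  by (simp add: hbar_prod_def mult.commute)

text \<open>Shifting moves factor \<open>m\<close> to factor \<open>m + 1\<close>, and
  \<open>hbar + b\<close> supplies the missing factor \<open>m = 0\<close>.\<close>

lemma hbar_prod_sigma: "(hbar + pconst b) * sigma i (hbar_prod r) = hbar_prod (Suc r)"
proof -
  have "sigma i (hbar + pconst (b - of_nat m)) = hbar + pconst (b - of_nat (Suc m))" for m
    using pconst_diff [of "b - of_nat m" 1, where 'a = 'n]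
    by (simp add: sigma_hom sigma_hbar algebra_simps)
  then show ?thesis
    unfolding hbar_prod_def prod.lessThan_Suc_shift
    by (simp add: sigma_ring_hom del: prod.lessThan_Suc)
qed

text \<open>Each descent step pays one more factor: both \<open>sigma i f\<close> and
  \<open>f\<close> times \<open>hbar_prod (Suc r)\<close> lie in \<open>W\<close>, hence so does
  their difference. Therefore \<open>r\<close> varies in the induction.\<close>

lemma hbar_prod_in:
  assumes S: "S = UNIV" and "hbar_prod r * f \<in> W" "f \<noteq> 0"
  shows "\<exists>r. hbar_prod r \<in> W"
proof -
  obtain d where "deg_less d f"
    using deg_less_exists by blast
  then show ?thesis
    using assms(2,3)
  proof (induction d arbitrary: r f)
    case 0
    then show ?case using deg_less_0 by blast
  next
    case (Suc d)
    show ?case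
    proof (cases "\<exists>i. sigma i f \<noteq> f")
      case True
      then obtain i where i: "sigma i f \<noteq> f" by blast
      have "(hbar + pconst b) * sigma i (hbar_prod r * f) \<in> W"
        using unit_act_closed [of "Some i" None] Suc.prems S by (simp add: ucoef_def)
      then have "hbar_prod (Suc r) * sigma i f \<in> W"
        by (simp only: sigma_hom hbar_prod_sigma [of i, symmetric] mult.assoc)
      moreover have "hbar_prod (Suc r) * f \<in> W"
        using mult [OF Suc.prems(2)] by (simp add: hbar_prod_Suc mult.assoc)
      ultimately have "hbar_prod (Suc r) * (sigma i f - f) \<in> W"
        by (simp add: right_diff_distrib diff)
      moreover have "deg_less d (sigma i f - f)"
        using deg_less_sigma [OF Suc.prems(1)] by simp
      ultimately show ?thesis
        using Suc.IH i by auto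
    next
      case False
      then have "tau i f = f" for i
        by (metis tau_sigma)
      then obtain c where "f = pconst c"
        using shift_invariant_const by blast
      then show ?thesis
        using Suc.prems pconst_cancel [of c "hbar_prod r"] by (cases "c = 0") (auto simp: mult.commute)
    qed
  qed
qed

text \<open>This applies \<open>(hvar j - b) * tau j\<close> to \<open>hbar_prod r\<close> in total
  \<open>k\<close> times. Factors in \<open>hvar j\<close> accumulate while the roots of the factors
  in \<open>hbar\<close> move down by \<open>k\<close>.\<close>

lemma lowered_hbar_prod_in:
  assumes "S = UNIV" "hbar_prod r \<in> W"
  shows "(\<Prod>m<k. hvar j - pconst (b - of_nat m))
    * (\<Prod>m<r. hbar + pconst (b - of_nat m + of_nat k)) \<in> W"
proof (induction k)
  case 0
  then show ?case using assms by (simp add: hbar_prod_def)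
next
  case (Suc k)
  let ?f = "(\<Prod>m<k. hvar j - pconst (b - of_nat m))
    * (\<Prod>m<r. hbar + pconst (b - of_nat m + of_nat k))"
  have "tau j (hvar j - pconst (b - of_nat m)) = hvar j - pconst (b - of_nat (Suc m))" for m
    using pconst_diff [of "b - of_nat m" 1, where 'a = 'n]
    by (simp add: tau_hom tau_hvar algebra_simps)
  moreover have "tau j (hbar + pconst (b - of_nat m + of_nat k))
      = hbar + pconst (b - of_nat m + of_nat (Suc k))" for m
    using pconst_add [of "b - of_nat m + of_nat k" 1, where 'a = 'n]
    by (simp add: tau_hom tau_hbar algebra_simps)
  ultimately have "(hvar j - pconst b) * tau j ?f
      = (\<Prod>m<Suc k. hvar j - pconst (b - of_nat m))
        * (\<Prod>m<r. hbar + pconst (b - of_nat m + of_nat (Suc k)))"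
    unfolding prod.lessThan_Suc_shift
    by (simp only: tau_hom finite_lessThan mult.assoc of_nat_0 diff_zero)
  moreover have "(hvar j - pconst b) * tau j ?f \<in> W"
    using uminus [OF unit_act_closed [OF _ Suc, of None "Some j"]] assms(1)
    by (simp add: wcoef_def del: minus_diff_eq)
  ultimately show ?case by simp
qed

text \<open>
  If \<open>1 \<notin> W\<close>, the commuting operators \<open>h\<^sub>j\<close> and \<open>\<Sum>\<^sub>j h\<^sub>j\<close> on the quotient by \<open>W\<close> are annihilated
  by products of linear factors, so they have a common eigenvector. The eigenvalue of \<open>h\<^sub>j\<close> is
  \<open>b - m\<^sub>j\<close> and that of the sum is \<open>m\<^sub>0 - b\<close>.
\<close>

lemma one_in_UNIV:
  assumes S: "S = UNIV" and f: "f \<in> W" "f \<noteq> 0" and b: "of_nat (CARD('n) + 1) * b \<notin> \<nat>"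
  shows "1 \<in> W"
proof (rule ccontr)
  assume one: "1 \<notin> W"
  obtain r where r: "hbar_prod r \<in> W"
    using hbar_prod_in [OF S, of 0 f] f by (auto simp: hbar_prod_def)
  then obtain h0 m0 where h0: "h0 \<notin> W" "(hbar + pconst (b - of_nat m0)) * h0 \<in> W"
    using prod_kills [of "{..<r}" 1 "\<lambda>m. hbar + pconst (b - of_nat m)"] one
    by (auto simp: hbar_prod_def)
  have "\<exists>h. h \<notin> W \<and> (hbar + pconst (b - of_nat m0)) * h \<in> W
      \<and> (\<forall>j\<in>J. \<exists>m. (hvar j - pconst (b - of_nat m)) * h \<in> W)" if "finite J" for J :: "'n set"
    using that
  proof (induction J rule: finite_induct)
    case empty
    then show ?case using h0 by auto
  next
    case (insert j J)
    then obtain h where h: "h \<notin> W" "(hbar + pconst (b - of_nat m0)) * h \<in> W"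
      and J: "\<forall>j\<in>J. \<exists>m. (hvar j - pconst (b - of_nat m)) * h \<in> W" by blast
    \<comment> \<open>With \<open>k = r\<close> the roots in \<open>hbar\<close> are
      \<open>m - r - b\<close> for \<open>m < r\<close>. None equals the eigenvalue
      \<open>m0 - b\<close>, so \<open>?P\<close> cannot kill the class of \<open>h\<close>.\<close>
    let ?P = "\<Prod>m<r. hbar + pconst (b - of_nat m + of_nat r)"
    \<comment> \<open>Eigenvalue relations already obtained survive when \<open>h\<close> is
      replaced by a multiple.\<close>
    have keep: "l * (g * h) \<in> W" if "l * h \<in> W" for l g
      using mult [OF that, of g] by (simp add: mult.left_commute)
    have "?P * h \<notin> W"
    proof
      assume "?P * h \<in> W"
      then obtain g m where gm: "m < r" "g * h \<notin> W"
          "(hbar + pconst (b - of_nat m + of_nat r)) * (g * h) \<in> W"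
        using prod_kills [of "{..<r}" h "\<lambda>m. hbar + pconst (b - of_nat m + of_nat r)"] h
        by auto
      have "(hbar + pconst (b - of_nat m + of_nat r)) * (g * h)
          - (hbar + pconst (b - of_nat m0)) * (g * h) \<in> W"
        using gm keep [OF h(2)] by (intro diff)
      also have "(hbar + pconst (b - of_nat m + of_nat r)) * (g * h)
          - (hbar + pconst (b - of_nat m0)) * (g * h)
          = pconst ((b - of_nat m + of_nat r) - (b - of_nat m0)) * (g * h)"
        by (simp only: pconst_diff [of "b - of_nat m + of_nat r"]) (simp add: algebra_simps)
      also have "(b - of_nat m + of_nat r) - (b - of_nat m0) = of_nat (r - m + m0)"
        using gm(1) by (simp add: of_nat_diff)
      finally show False
        using gm(1,2) pconst_cancel [of "of_nat (r - m + m0)"] by (simp del: of_nat_add)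
    qed
    moreover have "(\<Prod>m<r. hvar j - pconst (b - of_nat m)) * (?P * h) \<in> W"
      using mult [OF lowered_hbar_prod_in [OF S r, of j r], of h] by (simp add: mult_ac)
    ultimately obtain g m where "g * (?P * h) \<notin> W"
        "(hvar j - pconst (b - of_nat m)) * (g * (?P * h)) \<in> W"
      using prod_kills [of "{..<r}" "?P * h" "\<lambda>m. hvar j - pconst (b - of_nat m)"] by auto
    then have "g * ?P * h \<notin> W" "(hvar j - pconst (b - of_nat m)) * (g * ?P * h) \<in> W"
      by (simp_all add: mult.assoc)
    then show ?case
      using keep [of _ "g * ?P"] h J by blast
  qed
  from this [of UNIV] obtain h m where h: "h \<notin> W" "(hbar + pconst (b - of_nat m0)) * h \<in> W"
    and m: "\<And>j. (hvar j - pconst (b - of_nat (m j))) * h \<in> W"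
    by (simp only: finite ball_UNIV) metis
  let ?s = "\<Sum>j\<in>(UNIV :: 'n set). b - of_nat (m j)"
  have "(\<Sum>j\<in>UNIV. (hvar j - pconst (b - of_nat (m j))) * h) \<in> W"
    by (intro sum m)
  also have "(\<Sum>j\<in>UNIV. (hvar j - pconst (b - of_nat (m j))) * h) = (hbar - pconst ?s) * h"
    by (simp only: hbar_def pconst_sum sum_subtractf [symmetric] sum_distrib_right)
  finally have "(hbar + pconst (b - of_nat m0)) * h - (hbar - pconst ?s) * h \<in> W"
    using h by (intro diff)
  also have "(hbar + pconst (b - of_nat m0)) * h - (hbar - pconst ?s) * h
      = pconst (b - of_nat m0 + ?s) * h"
    by (simp only: pconst_add [of "b - of_nat m0"]) (simp add: algebra_simps)
  \<comment> \<open>\<open>hbar\<close> acts on the class of \<open>h\<close> both by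
    \<open>m0 - b\<close> and by \<open>?s\<close>; a nonzero difference would put \<open>h\<close>
    into \<open>W\<close>.\<close>
  finally have "b - of_nat m0 + ?s = 0"
    using h(1) pconst_cancel by blast
  then have "of_nat (CARD('n) + 1) * b = of_nat (m0 + (\<Sum>j\<in>UNIV. m j))"
    by (simp add: sum_subtractf algebra_simps)
  then show False
    using b by (metis of_nat_in_Nats)
qed

end

text \<open>An ideal containing 1 is everything, so both cases reduce to producing 1 from any
  nonzero element of a submodule.\<close>

lemma simple_sl_module_M:
  assumes "\<And>W f. M_submodule b S W \<Longrightarrow> f \<in> W \<Longrightarrow> f \<noteq> 0 \<Longrightarrow> 1 \<in> W"
  shows "simple_sl_module pscale (M_act b (S :: 'n::finite set))"
proof (intro simple_sl_module.intro simple_sl_module_axioms.intro sl_module_M)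
  show "\<exists>v::'n cpoly. v \<noteq> 0"
    by (rule exI [of _ 1]) simp
next
  fix W :: "'n cpoly set"
  assume "sl_module.submodule pscale (M_act b S) W"
  then interpret M_submodule b S W
    by unfold_locales
  show "W = {0} \<or> W = UNIV"
    using assms [OF M_submodule_axioms] zero one_imp_UNIV by blast
qed

theorem theorem32:
  shows "(\<forall>b::complex. of_nat (CARD('n::finite) + 1) * b \<notin> \<nat> \<longrightarrow>
            simple_sl_module pscale (M_act b (UNIV :: 'n set)))
       \<and> (\<forall>(b::complex) (S :: 'n set). S \<noteq> UNIV \<longrightarrow>
            simple_sl_module pscale (M_act b S))"
proof (intro conjI allI impI simple_sl_module_M)
  fix b :: complex and W :: "'n cpoly set" and f
  assume "of_nat (CARD('n) + 1) * b \<notin> \<nat>" "M_submodule b UNIV W" "f \<in> W" "f \<noteq> 0"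
  then show "1 \<in> W"
    by (intro M_submodule.one_in_UNIV [of b UNIV W f]) auto
next
  fix b :: complex and S :: "'n set" and W f
  assume "S \<noteq> UNIV" "M_submodule b S W" "f \<in> W" "f \<noteq> 0"
  then show "1 \<in> W"
    using M_submodule.one_in_proper by blast
qed

end
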